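(* For each $i\in\{3,r\}$, the $\mathcal{C}_i$-reflection preserves products in the category of topological monoids with open shifts: for every family $\{S_j\}_{j\in J}$ of topological monoids with open shifts, $\mathcal{C}_i\left(\prod_{j\in J}S_j\right)=\prod_{j\in J}\mathcal{C}_i(S_j)$.
   Context: A topological monoid is a monoid $S$ with a topology (no separation axiom assumed) for which the operation $S\times S\to S$ is continuous. It has open shifts if for every $a\in S$ and every open $U\subseteq S$ the sets $aU$ and $Ua$ are open in $S$. A space is $T_3$ if every point and every closed set not containing it have disjoint open neighborhoods ($T_1$ is not assumed); a space is regular if it is $T_3$ and $T_1$. $\mathcal{C}_3$ and $\mathcal{C}_r$ denote the classes of $T_3$ and of regular spaces. Each such class $\mathcal{C}$ is epireflective in the category of topological spaces: for each space $X$ there is a space $\mathcal{C}(X)\in\mathcal{C}$ and a continuous surjection $\varphi_{(\mathcal{C},X)}\colon X\to\mathcal{C}(X)$ (the $\mathcal{C}$-reflection) such that every continuous map $f\colon X\to Y$ with $Y\in\mathcal{C}$ factors as $f=g\circ\varphi_{(\mathcal{C},X)}$ for a unique continuous $g$. Products carry the product topology. The equality $\mathcal{C}(\prod_j S_j)=\prod_j\mathcal{C}(S_j)$ means that the canonical continuous map $k\colon\mathcal{C}(\prod_j S_j)\to\prod_j\mathcal{C}(S_j)$ with $k\circ\varphi_{(\mathcal{C},\prod_j S_j)}=\prod_j\varphi_{(\mathcal{C},S_j)}$ is a homeomorphism. *)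

theory Defs
  imports "HOL-Analysis.Analysis" "HOL-Algebra.Coset"
begin

locale topological_monoid = monoid G for G (structure) +
  fixes T :: "'a topology"
  assumes topspace_eq_carrier: "topspace T = carrier G"
    and continuous_mult: "continuous_map (prod_topology T T) T (\<lambda>(x, y). x \<otimes> y)"

locale open_shifts_monoid = topological_monoid +
  assumes open_left_shift: "\<lbrakk>a \<in> carrier G; openin T U\<rbrakk> \<Longrightarrow> openin T (a <# U)"
    and open_right_shift: "\<lbrakk>a \<in> carrier G; openin T U\<rbrakk> \<Longrightarrow> openin T (U #> a)"

datatype space_class = C3 | Cr

text \<open>The library predicate \<^const>\<open>regular_space\<close> does not include \<open>T\<^sub>1\<close>; it is the axiom \<open>T\<^sub>3\<close>.
  Regular spaces in the sense used here are the \<open>T\<^sub>3\<close> spaces that are also \<open>T\<^sub>1\<close>.\<close>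

fun in_class :: "space_class \<Rightarrow> 'a topology \<Rightarrow> bool" where
  "in_class C3 X \<longleftrightarrow> regular_space X"
| "in_class Cr X \<longleftrightarrow> regular_space X \<and> t1_space X"

text \<open>\<open>is_reflection i X R \<phi>\<close>: the space \<open>R\<close> together with the map \<open>\<phi>\<close> is the reflection of \<open>X\<close> in the
  class \<open>i\<close>.  A map out of \<open>R\<close> only matters on \<open>topspace R\<close>, hence the normalisation by
  \<^const>\<open>extensional\<close>.  A formula of HOL cannot quantify over all types, so the test spaces \<open>Y\<close> live
  on the type of the points of \<open>X\<close>.  This loses nothing: by \<open>is_reflection_universal\<close> below the
  universal property follows for test spaces on an arbitrary type, because the image of \<open>X\<close> under
  a map has at most as many points as \<open>X\<close>.\<close>

definition is_reflection ::
    "space_class \<Rightarrow> 'a topology \<Rightarrow> 'b topology \<Rightarrow> ('a \<Rightarrow> 'b) \<Rightarrow> bool" where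
  "is_reflection i X R \<phi> \<longleftrightarrow>
     in_class i R \<and> continuous_map X R \<phi> \<and> \<phi> ` topspace X = topspace R \<and>
     (\<forall>(Y :: 'a topology) f. in_class i Y \<and> continuous_map X Y f \<longrightarrow>
        (\<exists>!g. g \<in> extensional (topspace R) \<and> continuous_map R Y g \<and>
              (\<forall>x\<in>topspace X. f x = g (\<phi> x))))"

text \<open>The canonical maps from the reflection \<open>P\<close> (with \<open>\<psi>\<close>) of the product of the spaces \<open>X j\<close> to the
  product of their reflections \<open>R j\<close> (with \<open>\<phi> j\<close>).\<close>

definition is_canonical_map ::
    "'j set \<Rightarrow> ('j \<Rightarrow> 'a topology) \<Rightarrow> ('j \<Rightarrow> 'b topology) \<Rightarrow> ('j \<Rightarrow> 'a \<Rightarrow> 'b) \<Rightarrow>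
     'c topology \<Rightarrow> (('j \<Rightarrow> 'a) \<Rightarrow> 'c) \<Rightarrow> ('c \<Rightarrow> 'j \<Rightarrow> 'b) \<Rightarrow> bool" where
  "is_canonical_map J X R \<phi> P \<psi> k \<longleftrightarrow>
     continuous_map P (product_topology R J) k \<and>
     (\<forall>x\<in>topspace (product_topology X J). k (\<psi> x) = (\<lambda>j\<in>J. \<phi> j (x j)))"

lemma in_class_subtopology: "in_class i X \<Longrightarrow> in_class i (subtopology X A)"
  by (cases i) (auto simp: regular_space_subtopology t1_space_subtopology)

lemma in_class_homeomorphic: "X homeomorphic_space Y \<Longrightarrow> in_class i X \<longleftrightarrow> in_class i Y"
  by (cases i) (auto simp: homeomorphic_regular_space homeomorphic_t1_space)

lemma in_class_product:
  "(\<And>j. j \<in> J \<Longrightarrow> in_class i (X j)) \<Longrightarrow> in_class i (product_topology X J)"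
  by (cases i) (auto simp: regular_space_product_topology t1_space_product_topology)

lemma factor_unique:
  assumes "\<phi> ` topspace X = topspace R"
    and "g \<in> extensional (topspace R)" "\<forall>x\<in>topspace X. f x = g (\<phi> x)"
    and "g' \<in> extensional (topspace R)" "\<forall>x\<in>topspace X. f x = g' (\<phi> x)"
  shows "g = g'"
proof (rule extensionalityI[OF assms(2,4)])
  fix y assume "y \<in> topspace R"
  then obtain x where "x \<in> topspace X" "y = \<phi> x" using assms(1) by auto
  then show "g y = g' y" using assms(3,5) by metis
qed

lemma is_reflection_universal:
  fixes X :: "'a topology" and R :: "'b topology" and Y :: "'c topology"
  assumes refl: "is_reflection i X R \<phi>" and Y: "in_class i Y" and f: "continuous_map X Y f"
  shows "\<exists>!g. g \<in> extensional (topspace R) \<and> continuous_map R Y g \<and>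
              (\<forall>x\<in>topspace X. f x = g (\<phi> x))"
proof -
  let ?A = "topspace X"
  define s where "s = inv_into ?A f"
  define Z where "Z = pullback_topology (s ` f ` ?A) f Y"
  have fA: "f ` ?A \<subseteq> topspace Y" using f by (simp add: continuous_map_image_subset_topspace)
  have fs: "f (s y) = y" if "y \<in> f ` ?A" for y using that by (simp add: s_def f_inv_into_f)
  have topZ: "topspace Z = s ` f ` ?A"
    unfolding Z_def topspace_pullback_topology using fA fs by auto
  have cf: "continuous_map Z Y f"
    using continuous_map_pullback[OF continuous_map_id, of "s ` f ` ?A" f Y] by (simp add: Z_def)
  have cfZ: "continuous_map Z (subtopology Y (f ` ?A)) f"
    using cf fs by (auto simp: continuous_map_in_subtopology topZ)
  have cs: "continuous_map (subtopology Y (f ` ?A)) Z s"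
    unfolding Z_def
  proof (rule continuous_map_pullback')
    show "continuous_map (subtopology Y (f ` ?A)) Y (f \<circ> s)"
      by (rule continuous_map_eq[of _ _ id])
        (use fs in \<open>auto simp: continuous_map_from_subtopology\<close>)
  qed auto
  have "homeomorphic_maps Z (subtopology Y (f ` ?A)) f s"
    unfolding homeomorphic_maps_def using cfZ cs fs by (auto simp: topZ)
  then have "Z homeomorphic_space subtopology Y (f ` ?A)"
    by (auto simp: homeomorphic_space_def)
  then have "in_class i Z" using Y in_class_homeomorphic in_class_subtopology by blast
  moreover have "continuous_map X Z (s \<circ> f)"
  proof (rule continuous_map_compose[OF _ cs])
    show "continuous_map X (subtopology Y (f ` ?A)) f"
      using f by (auto simp: continuous_map_in_subtopology)
  qed
  ultimately obtain g where g: "continuous_map R Z g" "\<forall>x\<in>?A. (s \<circ> f) x = g (\<phi> x)"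
    using refl unfolding is_reflection_def by blast
  define h where "h = restrict (f \<circ> g) (topspace R)"
  have "continuous_map R Y h"
    by (rule continuous_map_eq[OF continuous_map_compose[OF g(1) cf]]) (simp add: h_def)
  moreover have \<phi>: "\<phi> ` topspace X = topspace R" using refl by (simp add: is_reflection_def)
  moreover have "\<forall>x\<in>?A. f x = h (\<phi> x)"
  proof
    fix x assume x: "x \<in> ?A"
    then have "\<phi> x \<in> topspace R" using \<phi> by auto
    moreover have "g (\<phi> x) = s (f x)" using g(2) x by fastforce
    ultimately have "h (\<phi> x) = f (s (f x))" by (simp add: h_def)
    then show "f x = h (\<phi> x)" using x fs by simp
  qed
  moreover have "h \<in> extensional (topspace R)" by (simp add: h_def)
  ultimately show ?thesis by (intro ex1I[of _ h] conjI) (auto intro: factor_unique[OF \<phi>])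
qed

text \<open>Reflections exist: the reflection is the image of \<open>X\<close> in the product of all spaces
  of the class on the given type, indexed by the continuous maps from \<open>X\<close>.\<close>

lemma is_reflection_exists:
  fixes X :: "'a topology"
  shows "\<exists>(R :: ('a topology \<times> ('a \<Rightarrow> 'a) \<Rightarrow> 'a) topology) \<phi>. is_reflection i X R \<phi>"
proof -
  define I where "I = {(Y :: 'a topology, f). in_class i Y \<and> continuous_map X Y f}"
  define P where "P = product_topology fst I"
  define d where "d = (\<lambda>x. \<lambda>p\<in>I. snd p x)"
  define R where "R = subtopology P (d ` topspace X)"
  have "continuous_map X (product_topology fst I) d"
    unfolding continuous_map_componentwise by (auto simp: d_def I_def)
  then have dP: "continuous_map X P d" by (simp add: P_def)
  then have topR: "d ` topspace X = topspace R"
    unfolding R_def using continuous_map_image_subset_topspace by fastforce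
  have dR: "continuous_map X R d"
    unfolding R_def using dP by (auto simp: continuous_map_in_subtopology)
  have R: "in_class i R"
    unfolding R_def P_def by (intro in_class_subtopology in_class_product) (auto simp: I_def)
  have "\<exists>!g. g \<in> extensional (topspace R) \<and> continuous_map R Y g \<and> (\<forall>x\<in>topspace X. f x = g (d x))"
    if "in_class i Y" "continuous_map X Y f" for Y :: "'a topology" and f
  proof -
    have p: "(Y, f) \<in> I" using that by (simp add: I_def)
    define g where "g = restrict (\<lambda>z. z (Y, f)) (topspace R)"
    have "continuous_map P (fst (Y, f)) (\<lambda>z. z (Y, f))"
      unfolding P_def by (rule continuous_map_product_projection[OF p])
    then have "continuous_map R Y (\<lambda>z. z (Y, f))"
      unfolding R_def by (simp add: continuous_map_from_subtopology)
    then have "continuous_map R Y g" by (rule continuous_map_eq) (simp add: g_def)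
    moreover have "\<forall>x\<in>topspace X. f x = g (d x)"
      using p topR by (auto simp: g_def d_def)
    moreover have "g \<in> extensional (topspace R)" by (simp add: g_def)
    ultimately show ?thesis by (intro ex1I[of _ g] conjI) (auto intro: factor_unique[OF topR])
  qed
  then have "is_reflection i X R d" unfolding is_reflection_def using R dR topR by blast
  then show ?thesis by blast
qed

end

theory Submission
  imports Defs
begin

text \<open>
  A topological monoid with open shifts has the following property: every point \<open>x\<close> of an open set
  \<open>U\<close> has an open neighbourhood \<open>W\<close> whose closure lies in the interior of the closure of \<open>U\<close>.  Indeed,
  choose open \<open>V \<ni> 1\<close> and \<open>W \<ni> x\<close> with \<open>V W \<subseteq> U\<close>; for \<open>y\<close> in the closure of \<open>W\<close> the open set \<open>V y\<close>
  contains \<open>y\<close> and lies in the closure of \<open>U\<close>.  In a space with this property the semiregularization,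
  generated by the sets \<open>int (cl U)\<close>, is \<open>T\<^sub>3\<close>, so these sets are preimages of open sets of the
  reflection.  Conversely, for a map \<open>f\<close> from the product to a \<open>T\<^sub>3\<close> space, every point of the preimage
  of an open set has a finite box \<open>\<Prod> U\<^sub>j\<close> around it such that \<open>\<Prod> int (cl U\<^sub>j)\<close> is contained in this
  preimage.  Hence \<open>f\<close> factors through the product of the reflections.
\<close>

section \<open>The semiregularization\<close>

text \<open>The topology with the regular open sets as a base. The open \<open>U\<close> lies in
  \<open>X interior_of (X closure_of U)\<close>, so the condition makes \<open>A\<close> a union of
  regular open sets; asking for an open \<open>U\<close> around \<open>x\<close> keeps the check of
  intersections short.\<close>

definition semiregularization :: "'a topology \<Rightarrow> 'a topology" where
  "semiregularization X = topology (\<lambda>A. A \<subseteq> topspace X \<and>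
     (\<forall>x\<in>A. \<exists>U. openin X U \<and> x \<in> U \<and> X interior_of (X closure_of U) \<subseteq> A))"

lemma subset_interior_of_closure_of: "openin X U \<Longrightarrow> U \<subseteq> X interior_of (X closure_of U)"
  by (simp add: closure_of_subset interior_of_maximal openin_subset)

lemma openin_semiregularization:
  "openin (semiregularization X) A \<longleftrightarrow> A \<subseteq> topspace X \<and>
     (\<forall>x\<in>A. \<exists>U. openin X U \<and> x \<in> U \<and> X interior_of (X closure_of U) \<subseteq> A)"
proof -
  let ?op = "\<lambda>A. A \<subseteq> topspace X \<and>
     (\<forall>x\<in>A. \<exists>U. openin X U \<and> x \<in> U \<and> X interior_of (X closure_of U) \<subseteq> A)"
  have "istopology ?op"
    unfolding istopology_def
  proof (intro conjI allI impI)
    fix A B assume A: "?op A" and B: "?op B"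
    show "A \<inter> B \<subseteq> topspace X" using A by blast
    show "\<forall>x\<in>A \<inter> B. \<exists>U. openin X U \<and> x \<in> U \<and> X interior_of (X closure_of U) \<subseteq> A \<inter> B"
    proof
      fix x assume "x \<in> A \<inter> B"
      then obtain U V where U: "openin X U" "x \<in> U" "X interior_of (X closure_of U) \<subseteq> A"
        and V: "openin X V" "x \<in> V" "X interior_of (X closure_of V) \<subseteq> B"
        using A B by (meson IntE)
      \<comment> \<open>The witness \<open>U \<inter> V\<close> works because closure and interior
        are monotone.\<close>
      have "X interior_of (X closure_of (U \<inter> V)) \<subseteq> A \<inter> B"
        using interior_of_mono[OF closure_of_mono[of "U \<inter> V" U X], of X]
          interior_of_mono[OF closure_of_mono[of "U \<inter> V" V X], of X] U(3) V(3) by blast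
      then show "\<exists>U. openin X U \<and> x \<in> U \<and> X interior_of (X closure_of U) \<subseteq> A \<inter> B"
        using U V by (meson IntI openin_Int)
    qed
  next
    fix K assume K: "\<forall>A\<in>K. ?op A"
    then show "\<Union> K \<subseteq> topspace X" by blast
    show "\<forall>x\<in>\<Union> K. \<exists>U. openin X U \<and> x \<in> U \<and> X interior_of (X closure_of U) \<subseteq> \<Union> K"
      using K by (meson Sup_upper UnionE order_trans)
  qed
  then show ?thesis by (simp add: semiregularization_def)
qed

lemma topspace_semiregularization [simp]: "topspace (semiregularization X) = topspace X"
proof (rule antisym)
  show "topspace (semiregularization X) \<subseteq> topspace X"
    using openin_semiregularization[THEN iffD1, OF openin_topspace] by (rule conjunct1)
  have "openin (semiregularization X) (topspace X)"
    unfolding openin_semiregularization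
    by (intro conjI ballI exI[of _ "topspace X"])
      (simp_all only: subset_refl openin_topspace interior_of_subset_topspace)
  then show "topspace X \<subseteq> topspace (semiregularization X)"
    by (rule openin_subset)
qed

lemma openin_semiregularization_imp_openin:
  assumes "openin (semiregularization X) A"
  shows "openin X A"
proof (subst openin_subopen, intro ballI)
  fix x assume "x \<in> A"
  then obtain U where "openin X U" "x \<in> U" "X interior_of (X closure_of U) \<subseteq> A"
    using assms openin_semiregularization by metis
  then show "\<exists>U. openin X U \<and> x \<in> U \<and> U \<subseteq> A"
    using subset_interior_of_closure_of by (metis order_trans)
qed

text \<open>The interior of \<open>C\<close> is its own witness at each of its points, since its
  closure stays inside \<open>C\<close>.\<close>

lemma openin_semiregularization_interior_of_closedin:
  assumes "closedin X C"
  shows "openin (semiregularization X) (X interior_of C)"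
  unfolding openin_semiregularization
proof (intro conjI ballI)
  show "X interior_of C \<subseteq> topspace X" by (rule interior_of_subset_topspace)
  fix x assume "x \<in> X interior_of C"
  moreover have "X closure_of (X interior_of C) \<subseteq> C"
    by (simp add: assms closure_of_minimal interior_of_subset)
  ultimately show "\<exists>U. openin X U \<and> x \<in> U \<and> X interior_of (X closure_of U) \<subseteq> X interior_of C"
    by (meson interior_of_mono openin_interior_of)
qed

lemma regular_space_semiregularization:
  assumes refine: "\<And>U x. \<lbrakk>openin X U; x \<in> U\<rbrakk> \<Longrightarrow>
    \<exists>W. openin X W \<and> x \<in> W \<and> X closure_of W \<subseteq> X interior_of (X closure_of U)"
  shows "regular_space (semiregularization X)"
  unfolding regular_space_def
proof (intro allI impI)
  fix C x assume Cx: "closedin (semiregularization X) C \<and> x \<in> topspace (semiregularization X) - C"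
  then have "openin (semiregularization X) (topspace X - C)" by (simp add: closedin_def)
  then obtain U where U: "openin X U" "x \<in> U" "X interior_of (X closure_of U) \<subseteq> topspace X - C"
    using Cx unfolding openin_semiregularization by (metis topspace_semiregularization)
  obtain W where W: "openin X W" "x \<in> W" "X closure_of W \<subseteq> X interior_of (X closure_of U)"
    using refine U by meson
  \<comment> \<open>\<open>?V\<close> is the complement of the closure of \<open>W\<close>. It
    contains \<open>C\<close> because that closure lies in
    \<open>X interior_of (X closure_of U)\<close>, which misses \<open>C\<close>. Both sets are
    interiors of closed sets.\<close>
  let ?W = "X interior_of (X closure_of W)" and ?V = "X interior_of (topspace X - W)"
  have "openin (semiregularization X) ?W" "openin (semiregularization X) ?V"
    using W by (auto intro!: openin_semiregularization_interior_of_closedin)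
  moreover have "x \<in> ?W" using subset_interior_of_closure_of[OF W(1)] W(2) by blast
  moreover have "C \<subseteq> ?V"
    using Cx W(3) U(3) closedin_subset by (fastforce simp: interior_of_complement)
  moreover have "disjnt ?W ?V"
    using interior_of_subset[of X "X closure_of W"] by (auto simp: disjnt_def interior_of_complement)
  ultimately show "\<exists>U V. openin (semiregularization X) U \<and> openin (semiregularization X) V \<and>
      x \<in> U \<and> C \<subseteq> V \<and> disjnt U V" by blast
qed

section \<open>Closures in monoids with open shifts\<close>

lemma (in open_shifts_monoid) closure_refinement:
  assumes U: "openin T U" and x: "x \<in> U"
  shows "\<exists>W. openin T W \<and> x \<in> W \<and> T closure_of W \<subseteq> T interior_of (T closure_of U)"
proof -
  have xG: "x \<in> carrier G" using U x openin_subset topspace_eq_carrier by auto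
  have "openin (prod_topology T T)
      {p \<in> topspace (prod_topology T T). (case p of (x, y) \<Rightarrow> x \<otimes> y) \<in> U}"
    by (rule openin_continuous_map_preimage[OF continuous_mult U])
  moreover have "(\<one>, x) \<in> {p \<in> topspace (prod_topology T T). (case p of (x, y) \<Rightarrow> x \<otimes> y) \<in> U}"
    using x xG by (simp add: topspace_eq_carrier)
  ultimately obtain V W where VW: "openin T V" "openin T W" "\<one> \<in> V" "x \<in> W"
    "V \<times> W \<subseteq> {p \<in> topspace (prod_topology T T). (case p of (x, y) \<Rightarrow> x \<otimes> y) \<in> U}"
    unfolding openin_prod_topology_alt by meson
  have "T closure_of W \<subseteq> T interior_of (T closure_of U)"
  proof
    fix y assume y: "y \<in> T closure_of W"
    then have yG: "y \<in> carrier G"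
      using closure_of_subset_topspace topspace_eq_carrier by fastforce
    \<comment> \<open>Left translation by \<open>v\<close> maps \<open>W\<close> into
      \<open>U\<close>; by continuity it maps the closure of \<open>W\<close>, and with it
      \<open>y\<close>, into the closure of \<open>U\<close>.\<close>
    have "V #> y \<subseteq> T closure_of U"
    proof
      fix z assume "z \<in> V #> y"
      then obtain v where v: "v \<in> V" "z = v \<otimes> y" by (auto simp: r_coset_def)
      have vG: "v \<in> topspace T" using v VW(1) openin_subset by auto
      have "continuous_map T T (\<lambda>w. v \<otimes> w)"
        using continuous_map_compose[OF _ continuous_mult, of T "\<lambda>w. (v, w)"] vG
        by (simp add: o_def continuous_map_pairedI)
      then have "(\<lambda>w. v \<otimes> w) ` (T closure_of W) \<subseteq> T closure_of ((\<lambda>w. v \<otimes> w) ` W)"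
        by (rule continuous_map_image_closure_subset)
      moreover have "(\<lambda>w. v \<otimes> w) ` W \<subseteq> U" using VW(5) v(1) by auto
      ultimately show "z \<in> T closure_of U" using y v(2) closure_of_mono by blast
    qed
    \<comment> \<open>Here open shifts enter: together with \<open>\<one> \<in> V\<close>, the set
      \<open>V #> y\<close> is an open neighbourhood of \<open>y\<close> inside the closure of
      \<open>U\<close>.\<close>
    moreover have "openin T (V #> y)" by (rule open_right_shift[OF yG VW(1)])
    moreover have "y \<in> V #> y" using VW(3) yG by (force simp: r_coset_def)
    ultimately show "y \<in> T interior_of (T closure_of U)"
      using interior_of_maximal by blast
  qed
  then show ?thesis using VW by blast
qed

section \<open>Reflections\<close>

text \<open>The test space is the Kolmogorov quotient of the semiregularization; it lies in both classes.\<close>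

lemma reflection_openin_semiregularization:
  assumes refl: "is_reflection i X R \<phi>" and reg: "regular_space (semiregularization X)"
    and A: "openin (semiregularization X) A"
  shows "\<exists>V. openin R V \<and> A = {x \<in> topspace X. \<phi> x \<in> V}"
proof -
  let ?Z = "semiregularization X"
  let ?q = "Kolmogorov_quotient ?Z"
  \<comment> \<open>\<open>?q\<close> picks representatives inside \<open>?Z\<close>, so the
    quotient is a subspace on the point type of \<open>X\<close>, as required of test spaces in
    \<open>is_reflection\<close>.\<close>
  let ?Y = "subtopology ?Z (?q ` topspace ?Z)"
  have "regular_space ?Y" using reg by (rule regular_space_subtopology)
  moreover have "t1_space ?Y"
    using calculation t0_space_Kolmogorov_quotient
    by (meson Hausdorff_imp_t1_space regular_t0_imp_Hausdorff_space)
  ultimately have "in_class i ?Y" by (cases i) auto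
  moreover have "continuous_map X ?Z id"
    unfolding continuous_map_def
  proof (intro conjI allI impI)
    fix U assume U: "openin ?Z U"
    then have "{x \<in> topspace X. id x \<in> U} = U"
      using openin_subset[OF U] by auto
    then show "openin X {x \<in> topspace X. id x \<in> U}"
      using openin_semiregularization_imp_openin[OF U] by simp
  qed simp
  then have "continuous_map X ?Z ?q"
    using continuous_map_compose[OF _ continuous_map_Kolmogorov_quotient] by fastforce
  then have "continuous_map X ?Y ?q"
    by (simp add: continuous_map_in_subtopology)
  ultimately obtain g where g: "continuous_map R ?Y g" "\<forall>x\<in>topspace X. ?q x = g (\<phi> x)"
    using refl unfolding is_reflection_def by blast
  have \<phi>: "\<phi> ` topspace X = topspace R" using refl by (simp add: is_reflection_def)
  have "continuous_map R ?Z g" using g(1) by (simp add: continuous_map_in_subtopology)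
  then have "openin R {y \<in> topspace R. g y \<in> A}"
    using A by (rule openin_continuous_map_preimage)
  \<comment> \<open>A point and its representative lie in the same open sets of \<open>?Z\<close>,
    so \<open>x \<in> A\<close> iff \<open>g (\<phi> x) \<in> A\<close>.\<close>
  moreover have "A = {x \<in> topspace X. \<phi> x \<in> {y \<in> topspace R. g y \<in> A}}"
  proof -
    have "x \<in> A \<longleftrightarrow> \<phi> x \<in> topspace R \<and> g (\<phi> x) \<in> A" if "x \<in> topspace X" for x
    proof -
      have "?q x = g (\<phi> x)" using g(2) that by (rule bspec)
      then show ?thesis
        using Kolmogorov_quotient_in_open[OF A, of x] imageI[OF that, of \<phi>] \<phi> by simp
    qed
    then show ?thesis using openin_subset[OF A] by auto
  qed
  ultimately show ?thesis by blast
qed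

text \<open>Without \<open>T\<^sub>1\<close>, the indiscrete topology on the points of
  \<open>X\<close> is an admissible test space, and the identity into it must factor through
  \<open>\<phi>\<close>.\<close>

lemma C3_reflection_inj_on:
  assumes refl: "is_reflection C3 X R \<phi>"
  shows "inj_on \<phi> (topspace X)"
proof -
  \<comment> \<open>Pulling back the one-point space along the constant map gives the indiscrete
    topology.\<close>
  let ?Y = "pullback_topology (topspace X) (\<lambda>_. ()) (discrete_topology UNIV)"
  have "regular_space ?Y"
    unfolding regular_space_def
  proof (intro allI impI)
    fix C a assume Ca: "closedin ?Y C \<and> a \<in> topspace ?Y - C"
    then have C: "openin ?Y (topspace ?Y - C)" "C \<subseteq> topspace ?Y" by (simp_all add: closedin_def)
    obtain B :: "unit set" where "topspace ?Y - C = (\<lambda>_. ()) -` B \<inter> topspace X"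
      using C(1) unfolding openin_pullback_topology by blast
    then have "topspace ?Y - C = topspace ?Y"
      using Ca by (auto simp: topspace_pullback_topology)
    then have "C = {}" using C(2) by blast
    then show "\<exists>U V. openin ?Y U \<and> openin ?Y V \<and> a \<in> U \<and> C \<subseteq> V \<and> disjnt U V"
      using Ca by (meson DiffD1 disjnt_empty2 empty_subsetI openin_empty openin_topspace)
  qed
  moreover have "continuous_map X ?Y id"
    by (rule continuous_map_pullback') (auto simp: o_def)
  ultimately obtain g where "\<forall>x\<in>topspace X. id x = g (\<phi> x)"
    using refl unfolding is_reflection_def in_class.simps by meson
  then show ?thesis by (auto simp: inj_on_def) metis
qed

section \<open>Maps from products to \<open>T\<^sub>3\<close> spaces\<close>

text \<open>By regularity of \<open>Y\<close>, put a closed \<open>C\<close> between a smaller open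
  \<open>V'\<close> and \<open>V\<close>. A basic box in the preimage of \<open>V'\<close> has its
  closure in the preimage of \<open>C\<close>, which leaves room to enlarge each side to the
  interior of its closure.\<close>

lemma regular_preimage_contains_box:
  assumes f: "continuous_map (product_topology X J) Y f" and Y: "regular_space Y"
    and V: "openin Y V" and x: "x \<in> topspace (product_topology X J)" "f x \<in> V"
  shows "\<exists>A. finite {j \<in> J. A j \<noteq> topspace (X j)} \<and>
    (\<forall>j\<in>J. openin (semiregularization (X j)) (A j)) \<and> x \<in> Pi\<^sub>E J A \<and>
    (\<forall>y\<in>Pi\<^sub>E J A. f y \<in> V)"
proof -
  let ?P = "product_topology X J"
  obtain V' C where V': "openin Y V'" "closedin Y C" "f x \<in> V'" "V' \<subseteq> C" "C \<subseteq> V"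
    using Y V x(2) unfolding neighbourhood_base_of_closedin[symmetric] neighbourhood_base_of
    by metis
  have "openin ?P {y \<in> topspace ?P. f y \<in> V'}"
    using f V'(1) by (rule openin_continuous_map_preimage)
  then obtain U where U: "finite {j \<in> J. U j \<noteq> topspace (X j)}" "\<forall>j\<in>J. openin (X j) (U j)"
      "x \<in> Pi\<^sub>E J U" "Pi\<^sub>E J U \<subseteq> {y \<in> topspace ?P. f y \<in> V'}"
    using x V'(3) unfolding openin_product_topology_alt by (smt (verit) mem_Collect_eq)
  define A where "A = (\<lambda>j. X j interior_of (X j closure_of U j))"
  \<comment> \<open>Full sides stay full under this enlargement.\<close>
  have "{j \<in> J. A j \<noteq> topspace (X j)} \<subseteq> {j \<in> J. U j \<noteq> topspace (X j)}"
    by (auto simp: A_def)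
  then have "finite {j \<in> J. A j \<noteq> topspace (X j)}" using U(1) finite_subset by blast
  moreover have "\<forall>j\<in>J. openin (semiregularization (X j)) (A j)"
    by (simp add: A_def openin_semiregularization_interior_of_closedin)
  moreover have "x \<in> Pi\<^sub>E J A"
    unfolding A_def PiE_iff
  proof (intro conjI ballI)
    fix j assume "j \<in> J"
    then show "x j \<in> X j interior_of (X j closure_of U j)"
      using U(2,3) subset_interior_of_closure_of PiE_mem by (metis subsetD)
  qed (use U(3) in \<open>simp add: PiE_iff\<close>)
  moreover have "f y \<in> V" if "y \<in> Pi\<^sub>E J A" for y
  proof -
    \<comment> \<open>The closure of a box is the product of the closures of its sides.\<close>
    have "Pi\<^sub>E J A \<subseteq> (\<Pi>\<^sub>E j\<in>J. X j closure_of U j)"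
      unfolding A_def by (rule PiE_mono) (rule interior_of_subset)
    then have "y \<in> ?P closure_of (Pi\<^sub>E J U)"
      using that unfolding closure_of_product_topology by (rule subsetD)
    also have "\<dots> \<subseteq> ?P closure_of {y \<in> topspace ?P. f y \<in> C}"
      using U(4) V'(4) by (intro closure_of_mono) auto
    also have "\<dots> = {y \<in> topspace ?P. f y \<in> C}"
      using closedin_continuous_map_preimage[OF f V'(2)] by (rule closure_of_closedin)
    finally show "f y \<in> V" using V'(5) by blast
  qed
  ultimately show ?thesis by blast
qed

lemma product_topology_map_surj:
  assumes "\<And>j. j \<in> J \<Longrightarrow> \<phi> j ` topspace (X j) = topspace (R j)"
    and z: "z \<in> topspace (product_topology R J)"
  shows "\<exists>x\<in>topspace (product_topology X J). (\<lambda>j\<in>J. \<phi> j (x j)) = z"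
proof
  let ?x = "\<lambda>j\<in>J. inv_into (topspace (X j)) (\<phi> j) (z j)"
  have zj: "z j \<in> \<phi> j ` topspace (X j)" if "j \<in> J" for j
    using z that assms(1) by (auto simp: PiE_iff)
  show "(\<lambda>j\<in>J. \<phi> j (?x j)) = z"
  proof
    fix j show "(\<lambda>j\<in>J. \<phi> j (?x j)) j = z j"
      using z zj[of j] by (cases "j \<in> J") (auto simp: PiE_iff extensional_def f_inv_into_f)
  qed
  show "?x \<in> topspace (product_topology X J)" using zj by (auto intro: inv_into_into)
qed

text \<open>The sides of the boxes found above are preimages of open sets of the \<open>R j\<close>.
  Hence \<open>f\<close> is controlled by open sets of the product of reflections, which yields
  continuity of the factor and, in the \<open>T\<^sub>1\<close> case, its well-definedness.\<close>

lemma product_of_reflections_factor: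
  assumes refl: "\<And>j. j \<in> J \<Longrightarrow> is_reflection i (X j) (R j) (\<phi> j)"
    and reg: "\<And>j. j \<in> J \<Longrightarrow> regular_space (semiregularization (X j))"
    and Y: "in_class i Y" and f: "continuous_map (product_topology X J) Y f"
  shows "\<exists>g. continuous_map (product_topology R J) Y g \<and>
    (\<forall>x\<in>topspace (product_topology X J). f x = g (\<lambda>j\<in>J. \<phi> j (x j)))"
proof -
  let ?P = "product_topology X J" and ?Q = "product_topology R J"
  define \<Phi> where "\<Phi> = (\<lambda>x. \<lambda>j\<in>J. \<phi> j (x j))"
  have surj_j: "\<phi> j ` topspace (X j) = topspace (R j)" if "j \<in> J" for j
    using refl[OF that] by (simp add: is_reflection_def)
  have surj: "\<exists>x\<in>topspace ?P. \<Phi> x = z" if "z \<in> topspace ?Q" for z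
    using product_topology_map_surj[of J \<phi> X R z] surj_j that by (simp add: \<Phi>_def)
  have regY: "regular_space Y" using Y by (cases i) auto
  have box: "\<exists>O'. openin ?Q O' \<and> \<Phi> x \<in> O' \<and> (\<forall>y\<in>topspace ?P. \<Phi> y \<in> O' \<longrightarrow> f y \<in> V)"
    if V: "openin Y V" and x: "x \<in> topspace ?P" "f x \<in> V" for V x
  proof -
    obtain A where A: "finite {j \<in> J. A j \<noteq> topspace (X j)}"
        "\<forall>j\<in>J. openin (semiregularization (X j)) (A j)"
        "x \<in> Pi\<^sub>E J A" "\<forall>y\<in>Pi\<^sub>E J A. f y \<in> V"
      using regular_preimage_contains_box[OF f regY V x] by (elim exE conjE) (rule that)
    have "\<forall>j\<in>J. \<exists>O'. openin (R j) O' \<and> A j = {x \<in> topspace (X j). \<phi> j x \<in> O'}"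
    proof
      fix j assume "j \<in> J"
      then show "\<exists>O'. openin (R j) O' \<and> A j = {x \<in> topspace (X j). \<phi> j x \<in> O'}"
        using reflection_openin_semiregularization[OF refl reg] A(2) by simp
    qed
    from bchoice[OF this] obtain B where "\<forall>j\<in>J. openin (R j) (B j) \<and>
        A j = {x \<in> topspace (X j). \<phi> j x \<in> B j}" ..
    then have B: "openin (R j) (B j)" "A j = {x \<in> topspace (X j). \<phi> j x \<in> B j}" if "j \<in> J" for j
      using that by simp_all
    \<comment> \<open>Surjectivity of \<open>\<phi> j\<close> makes \<open>B j\<close> full whenever
      \<open>A j\<close> is, so only finitely many sides of the new box are proper.\<close>
    have "B j = topspace (R j)" if "j \<in> J" "A j = topspace (X j)" for j
    proof (rule antisym)
      show "B j \<subseteq> topspace (R j)" using B(1)[OF that(1)] by (rule openin_subset)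
      show "topspace (R j) \<subseteq> B j"
        using B(2)[OF that(1)] that(2) unfolding surj_j[OF that(1), symmetric] by auto
    qed
    then have "{j \<in> J. B j \<noteq> topspace (R j)} \<subseteq> {j \<in> J. A j \<noteq> topspace (X j)}" by auto
    then have "finite {j \<in> J. B j \<noteq> topspace (R j)}" using A(1) by (rule finite_subset)
    then have "openin ?Q (Pi\<^sub>E J B)"
      using B(1) by (simp add: openin_PiE_gen)
    moreover have "\<Phi> x \<in> Pi\<^sub>E J B" using A(3) B(2) by (auto simp: \<Phi>_def PiE_iff)
    moreover have "f y \<in> V" if "y \<in> topspace ?P" "\<Phi> y \<in> Pi\<^sub>E J B" for y
      using A(4) B(2) that by (auto simp: \<Phi>_def PiE_iff)
    ultimately show ?thesis by blast
  qed
  \<comment> \<open>For \<open>C3\<close> the map \<open>\<Phi>\<close> is injective on the product.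
    For \<open>Cr\<close>, an open set separating \<open>f x\<close> from \<open>f y\<close> would
    contradict \<open>box\<close>, as \<open>\<Phi> x = \<Phi> y\<close>.\<close>
  have fibre: "f x = f y" if x: "x \<in> topspace ?P" and y: "y \<in> topspace ?P" and eq: "\<Phi> x = \<Phi> y" for x y
  proof (cases i)
    case C3
    have "x j = y j" if j: "j \<in> J" for j
    proof -
      have "\<phi> j (x j) = \<phi> j (y j)" using fun_cong[OF eq, of j] j by (simp add: \<Phi>_def)
      then show ?thesis
        using C3_reflection_inj_on[of "X j" "R j" "\<phi> j"] refl[OF j] C3 x y j
        by (auto simp: inj_on_def PiE_iff)
    qed
    then show ?thesis using x y by (metis PiE_ext topspace_product_topology)
  next
    case Cr
    have "f x \<in> topspace Y" "f y \<in> topspace Y" using f x y continuous_map_funspace by blast+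
    moreover have "t1_space Y" using Y Cr by simp
    ultimately have "\<exists>V. openin Y V \<and> f x \<in> V \<and> f y \<notin> V" if "f x \<noteq> f y"
      using that unfolding t1_space_def by simp
    then show ?thesis using box[OF _ x] eq y by metis
  qed
  \<comment> \<open>The value at \<open>z\<close> is read off at a chosen preimage; by
    \<open>fibre\<close> the choice does not matter.\<close>
  define g where "g = (\<lambda>z. f (inv_into (topspace ?P) \<Phi> z))"
  have g: "f x = g (\<Phi> x)" if "x \<in> topspace ?P" for x
    unfolding g_def using that fibre by (metis f_inv_into_f image_eqI inv_into_into)
  have "continuous_map ?Q Y g"
    unfolding continuous_map_def
  proof (intro conjI allI impI)
    show "g \<in> topspace ?Q \<rightarrow> topspace Y"
    proof
      fix z assume "z \<in> topspace ?Q"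
      then obtain x where x: "x \<in> topspace ?P" "\<Phi> x = z" using surj by blast
      then have "g z = f x" using g[OF x(1)] by simp
      then show "g z \<in> topspace Y" using funcset_mem[OF continuous_map_funspace[OF f] x(1)] by simp
    qed
    fix V assume V: "openin Y V"
    show "openin ?Q {z \<in> topspace ?Q. g z \<in> V}"
    proof (subst openin_subopen, intro ballI)
      fix z assume z: "z \<in> {z \<in> topspace ?Q. g z \<in> V}"
      then obtain x where x: "x \<in> topspace ?P" "\<Phi> x = z" using surj by blast
      then have "f x \<in> V" using g[OF x(1)] z by simp
      then obtain O' where O': "openin ?Q O'" "\<Phi> x \<in> O'" "\<forall>y\<in>topspace ?P. \<Phi> y \<in> O' \<longrightarrow> f y \<in> V"
        using box[OF V x(1)] by blast
      have "O' \<subseteq> {z \<in> topspace ?Q. g z \<in> V}"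
      proof
        fix w assume w: "w \<in> O'"
        then have wQ: "w \<in> topspace ?Q" using openin_subset[OF O'(1)] by blast
        then obtain y where y: "y \<in> topspace ?P" "\<Phi> y = w" using surj by blast
        then have "f y \<in> V" using O'(3) w by blast
        then show "w \<in> {z \<in> topspace ?Q. g z \<in> V}" using g[OF y(1)] y(2) wQ by simp
      qed
      then show "\<exists>O'. openin ?Q O' \<and> z \<in> O' \<and> O' \<subseteq> {z \<in> topspace ?Q. g z \<in> V}"
        using O' x(2) by blast
    qed
  qed
  then show ?thesis using g by (auto simp: \<Phi>_def)
qed

section \<open>The canonical map is a homeomorphism\<close>

theorem theorem3p3:
  fixes i :: space_class
    and J :: "'j set"
    and S :: "'j \<Rightarrow> 'a monoid"
    and T :: "'j \<Rightarrow> 'a topology"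
    and R :: "'j \<Rightarrow> 'b topology"
    and \<phi> :: "'j \<Rightarrow> 'a \<Rightarrow> 'b"
    and P :: "'c topology"
    and \<psi> :: "('j \<Rightarrow> 'a) \<Rightarrow> 'c"
  assumes "\<And>j. j \<in> J \<Longrightarrow> open_shifts_monoid (S j) (T j)"
    and "\<And>j. j \<in> J \<Longrightarrow> is_reflection i (T j) (R j) (\<phi> j)"
    and "is_reflection i (product_topology T J) P \<psi>"
  shows "(\<exists>k. is_canonical_map J T R \<phi> P \<psi> k) \<and>
         (\<forall>k. is_canonical_map J T R \<phi> P \<psi> k \<longrightarrow> homeomorphic_map P (product_topology R J) k)"
proof -
  let ?X = "product_topology T J" and ?Q = "product_topology R J"
  define \<Phi> where "\<Phi> = (\<lambda>x. \<lambda>j\<in>J. \<phi> j (x j))"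
  have reg: "regular_space (semiregularization (T j))" if "j \<in> J" for j
    using open_shifts_monoid.closure_refinement[OF assms(1)[OF that]]
    by (rule regular_space_semiregularization)
  have \<phi>: "in_class i (R j)" "continuous_map (T j) (R j) (\<phi> j)" "\<phi> j ` topspace (T j) = topspace (R j)"
    if "j \<in> J" for j
    using assms(2)[OF that] by (simp_all add: is_reflection_def)
  have \<psi>: "in_class i P" "continuous_map ?X P \<psi>" "\<psi> ` topspace ?X = topspace P"
    using assms(3) by (simp_all add: is_reflection_def)
  have "in_class i ?Q" using \<phi>(1) by (rule in_class_product)
  moreover have "continuous_map ?X ?Q \<Phi>"
  proof -
    have "continuous_map ?X (R j) (\<lambda>x. \<Phi> x j)" if "j \<in> J" for j
      using continuous_map_compose[of ?X "T j" "\<lambda>x. x j", OF _ \<phi>(2)[OF that]]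
        continuous_map_product_projection[OF that, of T] that
      by (simp add: \<Phi>_def o_def)
    then show ?thesis unfolding continuous_map_componentwise by (auto simp: \<Phi>_def)
  qed
  \<comment> \<open>The product of the reflections lies in the class but on another type than the
    test spaces in the definition, hence the general universal property.\<close>
  ultimately have ex: "\<exists>k. is_canonical_map J T R \<phi> P \<psi> k"
    using is_reflection_universal[OF assms(3), of ?Q \<Phi>] unfolding is_canonical_map_def \<Phi>_def
    by (auto simp del: topspace_product_topology)
  \<comment> \<open>The candidate inverse: \<open>P\<close> lies in the class, so
    \<open>\<psi>\<close> factors through the product of the reflections. As \<open>\<psi>\<close>
    and \<open>\<Phi>\<close> are onto, \<open>g\<close> is inverse to every canonical
    \<open>k\<close>.\<close>
  obtain g where g: "continuous_map ?Q P g" "\<forall>x\<in>topspace ?X. \<psi> x = g (\<Phi> x)"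
    using product_of_reflections_factor[OF assms(2) reg \<psi>(1,2)] unfolding \<Phi>_def by auto
  have "homeomorphic_map P ?Q k" if k: "is_canonical_map J T R \<phi> P \<psi> k" for k
  proof -
    have k: "continuous_map P ?Q k" "\<forall>x\<in>topspace ?X. k (\<psi> x) = \<Phi> x"
      using k by (simp_all add: is_canonical_map_def \<Phi>_def)
    have "g (k y) = y" if "y \<in> topspace P" for y
      using that \<psi>(3) g(2) k(2) by force
    moreover have "k (g z) = z" if z: "z \<in> topspace ?Q" for z
    proof -
      obtain x where "x \<in> topspace ?X" "\<Phi> x = z"
        using product_topology_map_surj[of J \<phi> T R z] \<phi>(3) z by (auto simp: \<Phi>_def)
      then show ?thesis using g(2) k(2) by metis
    qed
    ultimately have "homeomorphic_maps P ?Q k g"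
      unfolding homeomorphic_maps_def using g(1) k(1) by blast
    then show ?thesis using homeomorphic_map_maps by blast
  qed
  then show ?thesis using ex by blast
qed

end
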